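(* Let $\lambda>0$, $\delta=1/M$ with $M\geq 2$ an integer, $\varphi\in(0,2\pi]$, $\alpha>2$, $P_t,\mathcal G_m,\ell>0$, and $\omega := P_t\,\mathcal G_m^2\,\ell$. Consider the planar radar network described in the context with the cone antenna pattern, and let $\mathcal I_s$ be the power of the strongest interferer at the typical node over a detection slot. Then, for every $i>0$, $$F_{\mathcal I_s}(i) := \mathbb P\{\mathcal I_s\le i\} = \exp\left(-\frac{\lambda\,\delta\,\varphi^2\,\Omega\,\omega^{2/\alpha}}{4\pi}\cdot i^{-2/\alpha}\right),$$ where $\Omega=1$ in the no-fading case and $\Omega=\Gamma(1+2/\alpha)$ in the Rayleigh-fading case, with $\Gamma(x)=\int_0^\infty t^{x-1}e^{-t}\,dt$.
   Context: Network model. Radar devices are located at the points of a homogeneous Poisson point process (PPP) $\Phi=\{\mathbf x_i\}$ of intensity $\lambda$ on $\mathbb R^2$. Time is slotted. Each device carries an independent mark $m_i$ uniform on $\{0,\dots,M-1\}$ and transmits a pulse exactly in the slots $m_i+kM$, $k\in\mathbb N$. The typical node (the receiver) is located at the origin, in addition to the points of $\Phi$; in each cycle of $M$ slots it transmits in one slot and listens in the other $M-1$ slots, called detection slots. In a given detection slot, the active interferers thus form a thinned version $\Phi_{\mathcal I}$ of $\Phi$ of intensity $\delta\lambda$. Antennas. Each device, including the typical node, has a boresight direction that is uniform on $[0,2\pi)$, independently of everything else. Cone antenna pattern: the antenna gain of a device is $\mathcal G_m$ in directions within its beam (the planar sector of angular width $\varphi$ centred on its boresight direction) and $0$ elsewhere.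 The paper sets $\mathcal G_m=4\pi/\varphi^2$. Received interference power. The power received at the typical node from an active interferer at $\mathbf x\in\Phi_{\mathcal I}$ is $P_t\,\mathcal G_t\,\mathcal G_r\,\ell\,\zeta_{\mathbf x}\,\|\mathbf x\|^{-\alpha}$, where $P_t$ is the transmit power, $\ell=[c/(4\pi f)]^2$ is a positive constant ($c$ the speed of light, $f$ the carrier frequency), $\mathcal G_t$ is the gain of the antenna of the device at $\mathbf x$ in the direction of the origin, and $\mathcal G_r$ is the gain of the antenna of the typical node in the direction of $\mathbf x$. In the no-fading case $\zeta_{\mathbf x}\equiv 1$; in the Rayleigh-fading case the $\zeta_{\mathbf x}$ are i.i.d. exponential random variables of mean $1$, independent of everything else. The power of the strongest interferer is $$\mathcal I_s=\sup_{\mathbf x\in\Phi_{\mathcal I}} P_t\,\mathcal G_t\,\mathcal G_r\,\ell\,\zeta_{\mathbf x}\,\|\mathbf x\|^{-\alpha}.$$ *)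

theory Defs
  imports "HOL-Probability.Probability"
begin

text \<open>
  A homogeneous Poisson point process, given through a measurable enumeration of its points.
  Indexing by \<^typ>\<open>nat\<close> is no restriction, since for a positive intensity the process has
  almost surely infinitely many points. Points are counted through their indices, that is,
  with multiplicity. The local finiteness condition is needed because \<^const>\<open>card\<close> is 0 on
  infinite sets. The Poisson weights are written out because \<^const>\<open>poisson_pmf\<close> is only
  specified for a positive rate, while \<open>B\<close> may be a null set.
\<close>

definition poisson_point_process ::
    "'w measure \<Rightarrow> real \<Rightarrow> (nat \<Rightarrow> 'w \<Rightarrow> 'a::euclidean_space) \<Rightarrow> bool" where
  "poisson_point_process P lam X \<longleftrightarrow>
     (\<forall>n. X n \<in> borel_measurable P) \<and>
     (AE w in P. \<forall>B. bounded B \<longrightarrow> finite {n. X n w \<in> B}) \<and>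
     (\<forall>B\<in>sets borel. \<forall>k. bounded B \<longrightarrow>
        \<P>(w in P. card {n. X n w \<in> B} = k) =
          (lam * measure lborel B) ^ k / fact k * exp (- (lam * measure lborel B))) \<and>
     (\<forall>(J::nat set) B. finite J \<and> disjoint_family_on B J \<and>
          (\<forall>j\<in>J. B j \<in> sets borel \<and> bounded (B j)) \<longrightarrow>
        prob_space.indep_vars P (\<lambda>_. count_space UNIV) (\<lambda>j w. card {n. X n w \<in> B j}) J)"

datatype device = Typical | Other nat

datatype fading = No_Fading | Rayleigh

datatype randomness = Locations | Slot_Mark device | Boresight device | Fading_Coeff nat

text \<open>
  The sample space is \<open>P\<close>; \<open>lam\<close> is the intensity, \<open>M\<close> the cycle length, \<open>X n\<close> the location of
  device \<open>Other n\<close> (the typical device is at the origin), \<open>mark\<close> and \<open>bore\<close> the slot mark and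
  boresight direction of a device, and \<open>zeta n\<close> the fading coefficient between device \<open>Other n\<close>
  and the typical one. The point process enters the joint independence as one object, so that the
  marks are independent of all the locations together.
\<close>

locale radar_network = prob_space P
  for P :: "'w measure" +
  fixes lam :: real
    and M :: nat
    and fad :: fading
    and X :: "nat \<Rightarrow> 'w \<Rightarrow> real ^ 2"
    and mark :: "device \<Rightarrow> 'w \<Rightarrow> nat"
    and bore :: "device \<Rightarrow> 'w \<Rightarrow> real"
    and zeta :: "nat \<Rightarrow> 'w \<Rightarrow> real"
  assumes ppp: "poisson_point_process P lam X"
    and mark_measurable: "\<And>d. mark d \<in> measurable P (count_space UNIV)"
    and mark_uniform:
      "\<And>d. distr P (count_space UNIV) (mark d) = measure_pmf (pmf_of_set {0..<M})"
    and bore_measurable: "\<And>d. bore d \<in> borel_measurable P"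
    and bore_uniform: "\<And>d. distr P lborel (bore d) = uniform_measure lborel {0..<2 * pi}"
    and zeta_law:
      "\<And>n. case fad of
             No_Fading \<Rightarrow> (\<forall>w\<in>space P. zeta n w = 1)
           | Rayleigh \<Rightarrow> distributed P lborel (zeta n) (\<lambda>x. ennreal (exponential_density 1 x))"
    and independent:
      "indep_sets
         (\<lambda>s. case s of
             Locations \<Rightarrow>
               sets (vimage_algebra (space P) (\<lambda>w n. X n w) (\<Pi>\<^sub>M n\<in>UNIV. borel))
           | Slot_Mark d \<Rightarrow> sets (vimage_algebra (space P) (mark d) (count_space UNIV))
           | Boresight d \<Rightarrow> sets (vimage_algebra (space P) (bore d) borel)
           | Fading_Coeff n \<Rightarrow> sets (vimage_algebra (space P) (zeta n) borel))
         UNIV"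

definition transmits :: "nat \<Rightarrow> nat \<Rightarrow> nat \<Rightarrow> bool" where
  "transmits M m s \<longleftrightarrow> (\<exists>k. s = m + k * M)"

definition sector :: "real \<Rightarrow> real \<Rightarrow> (real ^ 2) set" where
  "sector \<phi> \<theta> =
     {r *\<^sub>R vector [cos (\<theta> + t), sin (\<theta> + t)] | r t. 0 \<le> r \<and> \<bar>t\<bar> \<le> \<phi> / 2}"

text \<open>The gain of an antenna with boresight \<open>\<theta>\<close> in the direction of the vector \<open>v\<close>.\<close>

definition cone_gain :: "real \<Rightarrow> real \<Rightarrow> real \<Rightarrow> real ^ 2 \<Rightarrow> real" where
  "cone_gain Gm \<phi> \<theta> v = (if v \<in> sector \<phi> \<theta> then Gm else 0)"

text \<open>
  Power received at the origin from a device at \<open>x\<close> with boresight \<open>\<theta>t\<close> and fading \<open>z\<close>,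
  when the receiver has boresight \<open>\<theta>r\<close>. The value 0 at \<open>x = 0\<close> is an artefact of
  \<^const>\<open>powr\<close>; almost surely no device is located there.
\<close>

definition received_power ::
    "real \<Rightarrow> real \<Rightarrow> real \<Rightarrow> real \<Rightarrow> real \<Rightarrow> real \<Rightarrow> real \<Rightarrow> real \<Rightarrow> real ^ 2 \<Rightarrow> real" where
  "received_power Pt Gm l \<phi> \<alpha> \<theta>r \<theta>t z x =
     Pt * cone_gain Gm \<phi> \<theta>t (0 - x) * cone_gain Gm \<phi> \<theta>r (x - 0) * l * z * norm x powr (- \<alpha>)"

text \<open>
  The supremum is taken in \<^typ>\<open>ennreal\<close>, where it always exists and is 0 when there is no
  active interferer.
\<close>

definition strongest_interferer ::
    "real \<Rightarrow> real \<Rightarrow> real \<Rightarrow> real \<Rightarrow> real \<Rightarrow> nat \<Rightarrow> (nat \<Rightarrow> 'w \<Rightarrow> real ^ 2) \<Rightarrow>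
     (device \<Rightarrow> 'w \<Rightarrow> nat) \<Rightarrow> (device \<Rightarrow> 'w \<Rightarrow> real) \<Rightarrow> (nat \<Rightarrow> 'w \<Rightarrow> real) \<Rightarrow>
     nat \<Rightarrow> 'w \<Rightarrow> ennreal" where
  "strongest_interferer Pt Gm l \<phi> \<alpha> M X mark bore zeta s w =
     (SUP n\<in>{n. transmits M (mark (Other n) w) s}.
        ennreal (received_power Pt Gm l \<phi> \<alpha> (bore Typical w) (bore (Other n) w) (zeta n w) (X n w)))"

definition fading_factor :: "fading \<Rightarrow> real \<Rightarrow> real" where
  "fading_factor fad \<alpha> = (case fad of No_Fading \<Rightarrow> 1 | Rayleigh \<Rightarrow> Gamma (1 + 2 / \<alpha>))"

end

theory Submission
  imports Defs
begin

text \<open>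
  The strongest interferer exceeds \<open>i\<close> exactly if some device does. Given the receiver's boresight
  and all the locations, the devices exceed \<open>i\<close> independently of each other, with a probability
  \<open>p x\<close> depending only on the location \<open>x\<close>, so the probability that none does is the infinite
  product of the factors \<open>1 - p (X n)\<close>. The generating functional of the Poisson process turns
  its expectation into \<open>exp (- \<lambda> \<integral>p)\<close>, and since \<open>p\<close> mixes indicators of disc sectors over the
  fading, \<open>\<integral>p\<close> is a moment of order \<open>2 / \<alpha>\<close> of the fading coefficient.
\<close>

subsection \<open>Sectors\<close>

text \<open>All devices share the receiver's beam, so their exceedances are in general dependent
  until its boresight is frozen at some \<open>\<theta>\<close>. The area of a sector does not
  depend on its orientation, so the final average over \<open>\<theta>\<close> is that of a
  constant. Conditioning is done without kernels: disjoint sets of random sources generate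
  independent \<sigma>-algebras, and a Fubini rule lets one block be frozen while the other is
  integrated.

  The process is known only through its counts in bounded Borel sets. Hence the generating
  functional is computed for simple functions of bounded support, where a product over points is a
  product of powers of counts, and reaches general \<open>p\<close> by monotone approximation.
  Infinite products are infima of finite ones in \<open>ennreal\<close>: the factors lie in [0, 1],
  so the infimum is the limit, and infima commute.

  The constant \<phi>^2 / (4 pi M) is the product of 1 / M (the slot), \<phi> / (2 pi) (the device
  faces the origin) and \<phi> / 2 (area of the receiver's sector in the unit disc). The exponent 2
  / \<alpha> is the dimension of the plane over the path loss exponent.\<close>

abbreviation unit_vec :: "real \<Rightarrow> real ^ 2" where
  "unit_vec \<theta> \<equiv> vector [cos \<theta>, sin \<theta>]"

lemma inner_unit_vec: "unit_vec a \<bullet> unit_vec b = cos (a - b)"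
  by (simp add: inner_vec_def UNIV_2 cos_diff)

lemma norm_unit_vec [simp]: "norm (unit_vec a) = 1"
  by (simp add: norm_eq_sqrt_inner inner_unit_vec)

lemma ex_polar:
  fixes v :: "real ^ 2"
  shows "\<exists>t. 0 \<le> t \<and> t < 2 * pi \<and> v = norm v *\<^sub>R unit_vec t"
proof (cases "v = 0")
  case True
  then show ?thesis by (intro exI[of _ 0]) simp
next
  case False
  define x y where "x = v $ 1 / norm v" and "y = v $ 2 / norm v"
  have n2: "(norm v)\<^sup>2 = (v $ 1)\<^sup>2 + (v $ 2)\<^sup>2"
    by (simp only: power2_norm_eq_inner) (simp add: inner_vec_def UNIV_2 power2_eq_square)
  have "x\<^sup>2 + y\<^sup>2 = ((v $ 1)\<^sup>2 + (v $ 2)\<^sup>2) / (norm v)\<^sup>2"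
    by (simp add: x_def y_def power_divide add_divide_distrib)
  also have "\<dots> = 1"
    using False n2[symmetric] by simp
  finally obtain t where t: "0 \<le> t" "t < 2 * pi" "x = cos t" "y = sin t"
    using sincos_total_2pi by blast
  have "v $ 1 = norm v * cos t" "v $ 2 = norm v * sin t"
    unfolding t(3,4)[symmetric] using False by (simp_all add: x_def y_def)
  then have "v = norm v *\<^sub>R unit_vec t"
    unfolding vec_eq_iff forall_2 by simp
  with t show ?thesis by blast
qed

text \<open>The start \<open>a\<close> of the period is free, so that an angle can be chosen within
  half a turn of a given boresight, where the cosine determines its distance from the
  boresight.\<close>

lemma ex_polar_from:
  fixes v :: "real ^ 2"
  shows "\<exists>t. a \<le> t \<and> t < a + 2 * pi \<and> v = norm v *\<^sub>R unit_vec t"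
proof -
  obtain t where t: "0 \<le> t" "t < 2 * pi" "v = norm v *\<^sub>R unit_vec t"
    using ex_polar by blast
  \<comment> \<open>The least number of full turns that lifts \<open>t\<close> to at least
    \<open>a\<close>.\<close>
  define k where "k = \<lceil>(a - t) / (2 * pi)\<rceil>"
  have k: "(a - t) / (2 * pi) \<le> k" "k < (a - t) / (2 * pi) + 1"
    unfolding k_def by linarith+
  have "a \<le> t + 2 * pi * k" "t + 2 * pi * k < a + 2 * pi"
    using k by (simp_all add: field_simps)
  moreover have "unit_vec (t + 2 * pi * k) = unit_vec t"
    by (simp add: cos_add sin_add)
  then have "v = norm v *\<^sub>R unit_vec (t + 2 * pi * k)"
    by (rule ssubst) (rule t(3))
  ultimately show ?thesis by blast
qed

lemma abs_le_iff_cos_le: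
  assumes "\<bar>t\<bar> \<le> pi" "0 \<le> b" "b \<le> pi"
  shows "cos b \<le> cos t \<longleftrightarrow> \<bar>t\<bar> \<le> b"
  using cos_mono_le_eq[OF assms(2,3) abs_ge_zero assms(1)] by (simp only: cos_abs_real)

text \<open>Half the width is at most \<open>pi\<close>, where the cosine decreases, so the angle to
  the boresight can be compared through the inner product. This form has no quantifier over angles:
  joint measurability and the action of rotations can be read off from it.\<close>

lemma mem_sector_iff:
  assumes "0 < \<phi>" "\<phi> \<le> 2 * pi"
  shows "v \<in> sector \<phi> \<theta> \<longleftrightarrow> norm v * cos (\<phi> / 2) \<le> v \<bullet> unit_vec \<theta>"
proof
  assume "v \<in> sector \<phi> \<theta>"
  then obtain r t where v: "v = r *\<^sub>R unit_vec (\<theta> + t)" and r: "0 \<le> r" and t: "\<bar>t\<bar> \<le> \<phi> / 2"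
    unfolding sector_def by blast
  have "cos (\<phi> / 2) \<le> cos t"
    using abs_le_iff_cos_le[of t "\<phi> / 2"] t assms by simp
  then show "norm v * cos (\<phi> / 2) \<le> v \<bullet> unit_vec \<theta>"
    using r by (simp add: v inner_unit_vec mult_left_mono)
next
  assume *: "norm v * cos (\<phi> / 2) \<le> v \<bullet> unit_vec \<theta>"
  obtain t where t: "\<theta> - pi \<le> t" "t < \<theta> - pi + 2 * pi" "v = norm v *\<^sub>R unit_vec t"
    using ex_polar_from by blast
  show "v \<in> sector \<phi> \<theta>"
  proof (cases "v = 0")
    case True
    then show ?thesis
      using assms unfolding sector_def by (auto intro!: exI[of _ 0])
  next
    case False
    have "v \<bullet> unit_vec \<theta> = norm v * cos (t - \<theta>)"
      by (subst t(3)) (simp add: inner_unit_vec)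
    with * False have "cos (\<phi> / 2) \<le> cos (t - \<theta>)" by simp
    then have "\<bar>t - \<theta>\<bar> \<le> \<phi> / 2"
      using abs_le_iff_cos_le[of "t - \<theta>" "\<phi> / 2"] t assms by simp
    moreover have "\<theta> + (t - \<theta>) = t" by simp
    then have "v = norm v *\<^sub>R unit_vec (\<theta> + (t - \<theta>))"
      by (rule ssubst) (rule t(3))
    ultimately show ?thesis
      unfolding sector_def using norm_ge_zero by blast
  qed
qed

lemma continuous_unit_vec: "continuous_on UNIV unit_vec"
proof -
  have "unit_vec = (\<lambda>\<theta>. \<chi> i. if i = 1 then cos \<theta> else sin \<theta>)"
    by (auto simp: fun_eq_iff vec_eq_iff forall_2)
  moreover have "continuous_on UNIV (\<lambda>\<theta>. (\<chi> i. if i = 1 then cos \<theta> else sin \<theta>) :: real ^ 2)"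
    by (intro continuous_on_vec_lambda, rename_tac i, case_tac "i = 1")
      (auto intro!: continuous_intros)
  ultimately show ?thesis by (simp only:)
qed

text \<open>Vector and boresight vary together, because both are random in the network and the area
  of a sector is found by integrating over both.\<close>

lemma measurable_mem_sector:
  assumes "0 < \<phi>" "\<phi> \<le> 2 * pi"
    and [measurable]: "f \<in> borel_measurable N" "g \<in> borel_measurable N"
  shows "Measurable.pred N (\<lambda>x. f x \<in> sector \<phi> (g x))"
proof -
  have [measurable]: "unit_vec \<in> borel_measurable borel"
    using continuous_unit_vec by (rule borel_measurable_continuous_onI)
  show ?thesis
    unfolding mem_sector_iff[OF assms(1,2)] by measurable
qed

lemma sets_sector:
  assumes "0 < \<phi>" "\<phi> \<le> 2 * pi"
  shows "sector \<phi> \<theta> \<in> sets borel"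
  using measurable_mem_sector[OF assms, of "\<lambda>x. x" borel "\<lambda>_. \<theta>"] unfolding pred_def by simp

text \<open>A periodic set has the same measure in every period; the period starting half a turn away
  from the direction of \<open>v\<close> contains the admissible boresights as one interval.\<close>

lemma emeasure_boresights:
  assumes \<phi>: "0 < \<phi>" "\<phi> \<le> 2 * pi" and "v \<noteq> 0"
  shows "emeasure lborel {\<theta> \<in> {0..<2 * pi}. v \<in> sector \<phi> \<theta>} = ennreal \<phi>"
proof -
  define A where "A = {\<theta>. v \<in> sector \<phi> \<theta>}"
  have A_eq: "A = {\<theta>. norm v * cos (\<phi> / 2) \<le> v \<bullet> unit_vec \<theta>}"
    by (simp add: A_def mem_sector_iff[OF \<phi>])
  have [measurable]: "A \<in> sets borel"
    using measurable_mem_sector[OF \<phi>, of "\<lambda>_. v" borel "\<lambda>x. x"] unfolding A_def pred_def by simp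
  \<comment> \<open>\<open>a\<close> is the direction opposite to \<open>v\<close>, so
    \<open>v\<close> points to the middle of the period from \<open>a\<close> to
    \<open>a + 2 * pi\<close>.\<close>
  obtain a where a: "0 \<le> a" "a < 2 * pi" "- v = norm v *\<^sub>R unit_vec a"
    using ex_polar[of "- v"] by auto
  have v: "v = norm v *\<^sub>R unit_vec (a + pi)"
  proof -
    have "unit_vec (a + pi) = - unit_vec a"
      by (simp add: vec_eq_iff forall_2)
    then show ?thesis using a(3) by (metis minus_minus scaleR_minus_right)
  qed
  have mem: "\<theta> \<in> A \<longleftrightarrow> cos (\<phi> / 2) \<le> cos (\<theta> - (a + pi))" for \<theta>
  proof -
    have "v \<bullet> unit_vec \<theta> = norm v * cos (a + pi - \<theta>)"
      by (subst v) (simp only: inner_scaleR_left inner_unit_vec)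
    also have "cos (a + pi - \<theta>) = cos (\<theta> - (a + pi))"
      by (metis cos_minus minus_diff_eq)
    finally show ?thesis using \<open>v \<noteq> 0\<close> by (simp add: A_eq)
  qed
  have period: "\<theta> + 2 * pi \<in> A \<longleftrightarrow> \<theta> \<in> A" for \<theta>
  proof -
    have "\<theta> + 2 * pi - (a + pi) = \<theta> - (a + pi) + 2 * pi" by simp
    then show ?thesis unfolding mem by (metis cos_periodic)
  qed
  have shift: "emeasure lborel {\<theta>. \<theta> + c \<in> B} = emeasure lborel B"
    if "B \<in> sets borel" for B and c :: real
  proof -
    have "emeasure lborel B = emeasure (distr lborel borel ((+) c)) B"
      by (simp add: lborel_distr_plus)
    also have "\<dots> = emeasure lborel {\<theta>. \<theta> + c \<in> B}"
      using that by (subst emeasure_distr) (auto simp: vimage_def add.commute)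
    finally show ?thesis by simp
  qed
  have "emeasure lborel (A \<inter> {0..<2 * pi})
        = emeasure lborel (A \<inter> {0..<a}) + emeasure lborel (A \<inter> {a..<2 * pi})"
    using a by (subst plus_emeasure) (auto intro!: arg_cong[where f = "emeasure lborel"])
  \<comment> \<open>Moving the initial piece by one full turn attaches it to the end of the rest and
    gives the period that starts at \<open>a\<close>.\<close>
  also have "emeasure lborel (A \<inter> {0..<a}) = emeasure lborel (A \<inter> {2 * pi..<a + 2 * pi})"
    using shift[of "A \<inter> {2 * pi..<a + 2 * pi}" "2 * pi", symmetric]
    by (auto simp: period intro!: arg_cong[where f = "emeasure lborel"])
  also have "\<dots> + emeasure lborel (A \<inter> {a..<2 * pi}) = emeasure lborel (A \<inter> {a..<a + 2 * pi})"
    using a by (subst plus_emeasure) (auto intro!: arg_cong[where f = "emeasure lborel"])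
  also have "\<dots> = emeasure lborel {u. u + (a + pi) \<in> A \<inter> {a..<a + 2 * pi}}"
    by (rule shift[symmetric]) measurable
  also have "{u. u + (a + pi) \<in> A \<inter> {a..<a + 2 * pi}} = {-(\<phi> / 2)..\<phi> / 2} \<inter> {- pi..<pi}"
    using abs_le_iff_cos_le[of _ "\<phi> / 2"] \<phi> by (fastforce simp: mem abs_le_iff)
  also have "emeasure lborel \<dots> = ennreal \<phi>"
  \<comment> \<open>For the full circle the closed interval sticks out of the half-open period by
    the single point \<open>pi\<close>.\<close>
  proof (cases "\<phi> = 2 * pi")
    case True
    then have "{-(\<phi> / 2)..\<phi> / 2} \<inter> {- pi..<pi} = {- pi..<pi}" by auto
    then show ?thesis using True by simp
  next
    case False
    then have "{-(\<phi> / 2)..\<phi> / 2} \<inter> {- pi..<pi} = {-(\<phi> / 2)..\<phi> / 2}" using \<phi> by auto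
    then show ?thesis using \<phi> by simp
  qed
  also have "A \<inter> {0..<2 * pi} = {\<theta> \<in> {0..<2 * pi}. v \<in> sector \<phi> \<theta>}"
    by (auto simp: A_def)
  finally show ?thesis .
qed

lemma emeasure_disc:
  assumes "0 \<le> R"
  shows "emeasure lborel (ball (0 :: real ^ 2) R) = ennreal (pi * R\<^sup>2)"
  using emeasure_ball[of R "0 :: real ^ 2"] assms by (simp add: unit_ball_vol_2)

text \<open>By rotation invariance the area does not depend on \<open>\<theta>\<close>; it is found by averaging over
  \<open>\<theta>\<close> and exchanging the order of integration.\<close>

lemma emeasure_sector_disc:
  assumes \<phi>: "0 < \<phi>" "\<phi> \<le> 2 * pi" and R: "0 \<le> R"
  shows "emeasure lborel (sector \<phi> \<theta> \<inter> ball 0 R) = ennreal (\<phi> / 2 * R\<^sup>2)"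
proof -
  define S where "S \<theta> = sector \<phi> \<theta> \<inter> ball 0 R" for \<theta>
  note [measurable] = measurable_mem_sector[OF \<phi>]
  have [measurable]: "S \<theta> \<in> sets borel" for \<theta>
    unfolding S_def using sets_sector[OF \<phi>] by (auto intro!: sets.Int)
  have bdd: "bounded (S \<theta>)" for \<theta>
    by (auto simp: S_def intro: bounded_subset[OF bounded_ball])
  \<comment> \<open>Invariance under orthogonal maps is a fact about Lebesgue measure, so the Borel
    sets are carried over to the completion.\<close>
  have lm: "S \<theta> \<in> lmeasurable" for \<theta>
    by (intro bounded_set_imp_lmeasurable bdd sets_completionI_sets) simp
  have em: "emeasure lborel (S \<theta>) = ennreal (measure lebesgue (S \<theta>))" for \<theta>
    using emeasure_bounded_finite[OF bdd, of \<theta>]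
    by (subst emeasure_eq_ennreal_measure) (auto simp: measure_completion)
  have const: "emeasure lborel (S \<theta>') = emeasure lborel (S \<theta>)" for \<theta>'
  proof -
    \<comment> \<open>An orthogonal map taking one boresight to the other preserves norms and inner
      products, hence maps one sector onto the other by \<open>mem_sector_iff\<close>.\<close>
    obtain f where f: "orthogonal_transformation f" "f (unit_vec \<theta>) = unit_vec \<theta>'"
      using orthogonal_transformation_exists[of "unit_vec \<theta>" "unit_vec \<theta>'"] by auto
    have "f ` S \<theta> = S \<theta>'"
    proof -
      have "f v \<in> S \<theta>' \<longleftrightarrow> v \<in> S \<theta>" for v
        using f orthogonal_transformation_norm[OF f(1), of v]
        by (auto simp: S_def mem_sector_iff[OF \<phi>] orthogonal_transformation_def
            simp flip: f(2))
      moreover have "surj f" using f(1) orthogonal_transformation_surj by blast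
      ultimately show ?thesis by (force simp: surj_def)
    qed
    then show ?thesis
      using measure_orthogonal_image[OF f(1) lm[of \<theta>]] by (simp add: em)
  qed
  have "ennreal (2 * pi) * emeasure lborel (S \<theta>)
        = (\<integral>\<^sup>+\<theta>'. emeasure lborel (S \<theta>) * indicator {0..<2 * pi} \<theta>' \<partial>lborel)"
    by (subst nn_integral_cmult_indicator) (auto simp: mult.commute)
  also have "\<dots> = (\<integral>\<^sup>+\<theta>'. emeasure lborel (S \<theta>') * indicator {0..<2 * pi} \<theta>' \<partial>lborel)"
    by (intro nn_integral_cong arg_cong2[where f = "(*)"] const[symmetric] refl)
  also have "\<dots> = (\<integral>\<^sup>+\<theta>'. \<integral>\<^sup>+v. indicator (S \<theta>') v * indicator {0..<2 * pi} \<theta>' \<partial>lborel \<partial>lborel)"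
    by (intro nn_integral_cong, subst nn_integral_multc) auto
  also have "\<dots> = (\<integral>\<^sup>+v. \<integral>\<^sup>+\<theta>'. indicator (S \<theta>') v * indicator {0..<2 * pi} \<theta>' \<partial>lborel \<partial>lborel)"
    by (rule lborel_pair.Fubini'[symmetric])
       (auto simp: S_def indicator_def split_beta' cong: measurable_cong_sets intro!: measurable_If)
  \<comment> \<open>The origin lies in every sector and has no direction; it is removed as a null
    set so that every remaining \<open>v\<close> has boresights of total length
    \<open>\<phi>\<close>.\<close>
  also have "\<dots> = (\<integral>\<^sup>+v. indicator (ball (0 :: real ^ 2) R - {0}) v * ennreal \<phi> \<partial>lborel)"
  proof (intro nn_integral_cong_AE)
    have "AE v in lborel. v \<noteq> (0 :: real ^ 2)" by (rule AE_lborel_singleton)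
    then show "AE v in lborel. (\<integral>\<^sup>+\<theta>'. indicator (S \<theta>') v * indicator {0..<2 * pi} \<theta>' \<partial>lborel)
        = indicator (ball (0 :: real ^ 2) R - {0}) v * ennreal \<phi>"
    proof eventually_elim
      case (elim v)
      have "(\<integral>\<^sup>+\<theta>'. indicator (S \<theta>') v * indicator {0..<2 * pi} \<theta>' \<partial>lborel)
        = (\<integral>\<^sup>+\<theta>'. indicator (ball 0 R) v * indicator {\<theta> \<in> {0..<2 * pi}. v \<in> sector \<phi> \<theta>} \<theta>' \<partial>lborel)"
        by (intro nn_integral_cong) (auto simp: S_def indicator_def)
      also have "\<dots> = indicator (ball 0 R) v * ennreal \<phi>"
        using emeasure_boresights[OF \<phi> elim] by (subst nn_integral_cmult_indicator) auto
      finally show ?case using elim by (simp add: indicator_def)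
    qed
  qed
  \<comment> \<open>The average is \<open>\<phi>\<close> times the disc area
    \<open>pi * R\<^sup>2\<close>; splitting off \<open>2 * pi\<close> leaves the claimed
    area.\<close>
  also have "\<dots> = ennreal (2 * pi) * ennreal (\<phi> / 2 * R\<^sup>2)"
    by (subst nn_integral_multc)
       (use \<phi> R emeasure_disc[OF R] in \<open>auto simp: emeasure_Diff_null_set null_sets_def
          simp flip: ennreal_mult' intro!: borel_measurable_indicator\<close>)
  finally have "emeasure lborel (S \<theta>) = ennreal (\<phi> / 2 * R\<^sup>2)"
    by (subst (asm) ennreal_mult_cancel_left) auto
  then show ?thesis by (simp add: S_def)
qed

subsection \<open>The generating functional of a Poisson process\<close>

lemma nn_integral_of_count:
  fixes f :: "nat \<Rightarrow> ennreal" and N :: "'w \<Rightarrow> nat"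
  assumes N: "N \<in> measurable P (count_space UNIV)"
  shows "(\<integral>\<^sup>+w. f (N w) \<partial>P) = (\<Sum>k. f k * emeasure P {w \<in> space P. N w = k})"
proof -
  define A where "A k = {w \<in> space P. N w = k}" for k
  have [measurable]: "A k \<in> sets P" for k
    using measurable_sets[OF N, of "{k}"] by (simp add: A_def vimage_def Int_def conj_commute)
  have "(\<integral>\<^sup>+w. f (N w) \<partial>P) = (\<integral>\<^sup>+w. (\<Sum>k. f k * indicator (A k) w) \<partial>P)"
    by (intro nn_integral_cong suminf_cmult_indicator[symmetric])
       (auto simp: A_def disjoint_family_on_def)
  also have "\<dots> = (\<Sum>k. f k * emeasure P (A k))"
    by (subst nn_integral_suminf) (auto simp: nn_integral_cmult_indicator)
  finally show ?thesis by (simp add: A_def)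
qed

text \<open>The probability generating function of the Poisson law, from the exponential series at
  \<open>q * \<mu>\<close>. The rate \<open>\<mu> = 0\<close> is included, as a level set of a
  simple function may be null.\<close>

lemma (in prob_space) nn_integral_power_Poisson:
  fixes N :: "'a \<Rightarrow> nat" and q \<mu> :: real
  assumes N: "N \<in> measurable M (count_space UNIV)"
    and law: "\<And>k. prob {w \<in> space M. N w = k} = \<mu> ^ k / fact k * exp (- \<mu>)"
    and "0 \<le> q" "0 \<le> \<mu>"
  shows "(\<integral>\<^sup>+w. ennreal (q ^ N w) \<partial>M) = ennreal (exp (- ((1 - q) * \<mu>)))"
proof -
  have "(\<integral>\<^sup>+w. ennreal (q ^ N w) \<partial>M)
      = (\<Sum>k. ennreal (q ^ k) * emeasure M {w \<in> space M. N w = k})"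
    by (rule nn_integral_of_count[OF N])
  also have "\<dots> = (\<Sum>k. ennreal ((q * \<mu>) ^ k /\<^sub>R fact k * exp (- \<mu>)))"
    using \<open>0 \<le> q\<close> \<open>0 \<le> \<mu>\<close>
    by (intro suminf_cong)
       (simp add: emeasure_eq_measure law power_mult_distrib field_simps flip: ennreal_mult)
  also have "\<dots> = ennreal (exp (q * \<mu>) * exp (- \<mu>))"
    using \<open>0 \<le> q\<close> \<open>0 \<le> \<mu>\<close>
    by (intro suminf_ennreal_eq sums_mult2 exp_converges) auto
  also have "exp (q * \<mu>) * exp (- \<mu>) = exp (- ((1 - q) * \<mu>))"
    by (simp add: algebra_simps flip: exp_add)
  finally show ?thesis .
qed

text \<open>Grouping the points by the value of \<open>f\<close> leaves only counts in level sets,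
  whose joint law the Poisson process provides.\<close>

lemma prod_eq_prod_level_counts:
  fixes x :: "nat \<Rightarrow> 'a" and f :: "'a \<Rightarrow> real"
  assumes "finite {n. f (x n) \<noteq> 0}" and "finite J" and h: "inj_on h J"
    and cover: "range f - {0} \<subseteq> h ` J" and "0 \<notin> h ` J"
  shows "(\<Prod>n | f (x n) \<noteq> 0. 1 - f (x n)) = (\<Prod>j\<in>J. (1 - h j) ^ card {n. x n \<in> f -` {h j}})"
proof -
  have fin: "finite {n. x n \<in> f -` {h j}}" if "j \<in> J" for j
    using assms(1) by (rule finite_subset[rotated]) (use that assms(5) in auto)
  have eq: "{n. f (x n) \<noteq> 0} = (\<Union>j\<in>J. {n. x n \<in> f -` {h j}})"
    using cover assms(5) by fastforce
  show ?thesis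
    unfolding eq using fin h \<open>finite J\<close>
    by (subst prod.UNION_disjoint) (auto simp: inj_on_def)
qed

text \<open>The partial products decrease and are constant once \<open>N\<close> has passed the last
  index of the support.\<close>

lemma INF_prod_finite_support:
  fixes f :: "nat \<Rightarrow> real"
  assumes fin: "finite {n. f n \<noteq> 0}" and f: "\<And>n. 0 \<le> f n" "\<And>n. f n \<le> 1"
  shows "(INF N. ennreal (\<Prod>n<N. 1 - f n)) = ennreal (\<Prod>n | f n \<noteq> 0. 1 - f n)"
proof (rule antisym)
  obtain m where m: "{n. f n \<noteq> 0} \<subseteq> {..<m}"
    using finite_nat_iff_bounded fin by blast
  have "(\<Prod>n<m. 1 - f n) = (\<Prod>n | f n \<noteq> 0. 1 - f n)"
    using m by (intro prod.mono_neutral_right) auto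
  then show "(INF N. ennreal (\<Prod>n<N. 1 - f n)) \<le> ennreal (\<Prod>n | f n \<noteq> 0. 1 - f n)"
    by (intro INF_lower2[of m]) auto
next
  have *: "(\<Prod>n | f n \<noteq> 0. 1 - f n) \<le> (\<Prod>n<N. 1 - f n)" for N
  proof -
    have "(\<Prod>n | f n \<noteq> 0. 1 - f n)
        = (\<Prod>n\<in>{n. f n \<noteq> 0} \<inter> {..<N}. 1 - f n) * (\<Prod>n\<in>{n. f n \<noteq> 0} - {..<N}. 1 - f n)"
      using fin by (intro prod.Int_Diff)
    also have "\<dots> \<le> (\<Prod>n\<in>{n. f n \<noteq> 0} \<inter> {..<N}. 1 - f n)"
      using f by (intro mult_left_le prod_le_1 prod_nonneg) auto
    also have "\<dots> = (\<Prod>n<N. 1 - f n)"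
      by (intro prod.mono_neutral_left) auto
    finally show ?thesis .
  qed
  show "ennreal (\<Prod>n | f n \<noteq> 0. 1 - f n) \<le> (INF N. ennreal (\<Prod>n<N. 1 - f n))"
    by (intro INF_greatest ennreal_leI *)
qed

text \<open>The nonzero level sets are disjoint, bounded and Borel, so their counts are independent
  and Poisson. The expectation factorises, and each factor is a generating function at one minus the
  level; the exponents add up to the integral of \<open>f\<close>.\<close>

lemma nn_integral_INF_prod_simple:
  fixes f :: "'a::euclidean_space \<Rightarrow> real"
  assumes "prob_space P" and ppp: "poisson_point_process P lam X" and lam: "0 \<le> lam"
    and sf: "simple_function borel f" and f: "\<And>x. 0 \<le> f x" "\<And>x. f x \<le> 1"
    and supp: "bounded {x. f x \<noteq> 0}"
  shows "(\<integral>\<^sup>+w. (INF N. ennreal (\<Prod>n<N. 1 - f (X n w))) \<partial>P)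
       = ennreal (exp (- (lam * integral\<^sup>L lborel f)))"
proof -
  interpret prob_space P by fact
  define R where "R = range f - {0}"
  have finR: "finite R" using sf by (auto simp: R_def simple_function_def)
  \<comment> \<open>The levels are numbered because the independence of counts is stated for
    families indexed by naturals.\<close>
  obtain h where h: "bij_betw h {..<card R} R"
    using ex_bij_betw_nat_finite[OF finR] by (auto simp: atLeast0LessThan)
  define J where "J = {..<card R}"
  have hJ: "inj_on h J" "h ` J = R" using h by (auto simp: J_def bij_betw_def)
  define B where "B j = f -` {h j}" for j
  have hR: "0 < h j \<and> h j \<le> 1" if "j \<in> J" for j
    using hJ(2) that f unfolding R_def by (metis DiffE image_iff imageI insertI1 order_le_less rangeE singleton_iff)
  have B: "B j \<in> sets borel" "bounded (B j)" if "j \<in> J" for j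
  proof -
    show "B j \<in> sets borel"
      using simple_functionD(2)[OF sf, of "{h j}"] by (simp add: B_def)
    show "bounded (B j)"
      using supp by (rule bounded_subset) (use hR[OF that] in \<open>auto simp: B_def\<close>)
  qed
  have disj: "disjoint_family_on B J"
    using hJ(1) by (auto simp: disjoint_family_on_def B_def inj_on_def)
  define C where "C j w = card {n. X n w \<in> B j}" for j w
  have ind: "indep_vars (\<lambda>_. count_space UNIV) C J"
    using ppp disj B unfolding poisson_point_process_def C_def
    by (auto simp: J_def)
  have C: "C j \<in> measurable P (count_space UNIV)" if "j \<in> J" for j
    using ind that unfolding indep_vars_def by auto
  have law: "prob {w \<in> space P. C j w = k}
      = (lam * measure lborel (B j)) ^ k / fact k * exp (- (lam * measure lborel (B j)))"
    if "j \<in> J" for j k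
    using ppp B[OF that] unfolding poisson_point_process_def C_def by blast
  have ind': "indep_vars (\<lambda>_. borel) (\<lambda>j w. ennreal ((1 - h j) ^ C j w)) J"
    by (rule indep_vars_compose2[OF ind]) auto
  have "(\<integral>\<^sup>+w. (INF N. ennreal (\<Prod>n<N. 1 - f (X n w))) \<partial>P)
      = (\<integral>\<^sup>+w. (\<Prod>j\<in>J. ennreal ((1 - h j) ^ C j w)) \<partial>P)"
  proof (rule nn_integral_cong_AE)
    \<comment> \<open>Local finiteness leaves almost surely finitely many factors different from
      1.\<close>
    have "AE w in P. finite {n. X n w \<in> {x. f x \<noteq> 0}}"
    proof -
      have "AE w in P. \<forall>B. bounded B \<longrightarrow> finite {n. X n w \<in> B}"
        using ppp unfolding poisson_point_process_def by blast
      then show ?thesis by eventually_elim (use supp in blast)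
    qed
    then show "AE w in P. (INF N. ennreal (\<Prod>n<N. 1 - f (X n w)))
        = (\<Prod>j\<in>J. ennreal ((1 - h j) ^ C j w))"
    proof eventually_elim
      case (elim w)
      have "(INF N. ennreal (\<Prod>n<N. 1 - f (X n w))) = ennreal (\<Prod>n | f (X n w) \<noteq> 0. 1 - f (X n w))"
        using elim f by (intro INF_prod_finite_support) auto
      also have "\<dots> = ennreal (\<Prod>j\<in>J. (1 - h j) ^ C j w)"
        unfolding C_def B_def using elim hJ
        by (subst prod_eq_prod_level_counts[of f "\<lambda>n. X n w" J h]) (auto simp: R_def J_def)
      also have "\<dots> = (\<Prod>j\<in>J. ennreal ((1 - h j) ^ C j w))"
        using hR by (intro prod_ennreal[symmetric]) auto
      finally show ?case .
    qed
  qed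
  also have "\<dots> = (\<Prod>j\<in>J. \<integral>\<^sup>+w. ennreal ((1 - h j) ^ C j w) \<partial>P)"
    by (intro indep_vars_nn_integral ind') (auto simp: J_def)
  also have "\<dots> = (\<Prod>j\<in>J. ennreal (exp (- (h j * (lam * measure lborel (B j))))))"
    using nn_integral_power_Poisson[OF C law] hR lam by (intro prod.cong refl) simp
  also have "\<dots> = ennreal (\<Prod>j\<in>J. exp (- (h j * (lam * measure lborel (B j)))))"
    by (intro prod_ennreal) auto
  also have "(\<Prod>j\<in>J. exp (- (h j * (lam * measure lborel (B j)))))
      = exp (- (lam * (\<Sum>j\<in>J. h j * measure lborel (B j))))"
    by (simp add: J_def sum_distrib_left sum_negf mult.left_commute flip: exp_sum)
  also have "(\<Sum>j\<in>J. h j * measure lborel (B j)) = integral\<^sup>L lborel f"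
  proof -
    have "f x = (\<Sum>j\<in>J. h j * indicator (B j) x)" for x
    proof (cases "f x = 0")
      case True
      then have "(\<Sum>j\<in>J. h j * indicator (B j) x) = 0"
        using hR by (intro sum.neutral) (force simp: B_def indicator_def)
      then show ?thesis using True by simp
    next
      case False
      then obtain k where k: "k \<in> J" "f x = h k" using hJ(2) by (auto simp: R_def)
      have "(\<Sum>j\<in>J. h j * indicator (B j) x) = (\<Sum>j\<in>J. if j = k then h k else 0)"
        using k hJ(1) by (intro sum.cong) (auto simp: B_def indicator_def inj_on_def)
      then show ?thesis using k by (simp add: J_def)
    qed
    then have "integral\<^sup>L lborel f = (\<integral>x. (\<Sum>j\<in>J. h j * indicator (B j) x) \<partial>lborel)"
      by presburger
    also have "\<dots> = (\<Sum>j\<in>J. h j * measure lborel (B j))"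
      using B by (subst Bochner_Integration.integral_sum) (auto intro!: integrable_mult_right integrable_real_indicator emeasure_bounded_finite)
    finally show ?thesis by simp
  qed
  finally show ?thesis .
qed

text \<open>Raising the approximations to \<open>p\<close> lowers the products, so the left side
  passes to the limit by monotone convergence for decreasing sequences, and the right side by
  dominated convergence with bound \<open>p\<close>.\<close>

lemma nn_integral_INF_prod_Poisson:
  fixes p :: "'a::euclidean_space \<Rightarrow> real"
  assumes "prob_space P" and ppp: "poisson_point_process P lam X" and lam: "0 \<le> lam"
    and int: "integrable lborel p" and p: "\<And>x. 0 \<le> p x" "\<And>x. p x \<le> 1"
  shows "(\<integral>\<^sup>+w. (INF N. ennreal (\<Prod>n<N. 1 - p (X n w))) \<partial>P)
       = ennreal (exp (- (lam * integral\<^sup>L lborel p)))"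
proof -
  interpret prob_space P by fact
  have [measurable]: "X n \<in> borel_measurable P" for n
    using ppp unfolding poisson_point_process_def by blast
  have [measurable]: "p \<in> borel_measurable borel" using int by auto
  obtain u where u: "incseq u" "\<And>k. simple_function borel (u k)"
      "\<And>x. bdd_above (range (\<lambda>k. u k x))" "\<And>k x. 0 \<le> u k x" "p = (SUP k. u k)"
    using borel_measurable_implies_simple_function_sequence_real[of p borel] p by auto
  have ulim: "(\<lambda>k. u k x) \<longlonglongrightarrow> p x" for x
  proof -
    have "p x = (SUP k. u k x)" by (simp add: u(5) image_image)
    then show ?thesis using LIMSEQ_incseq_SUP[OF u(3), of x] u(1) by (simp add: incseq_def le_fun_def)
  qed
  \<comment> \<open>The cut-off at radius \<open>k\<close> supplies the bounded support and keeps
    the sequence increasing.\<close>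
  define v where "v k x = indicator (cball 0 (real k)) x * u k x" for k x
  have v0: "0 \<le> v k x" for k x using u(4) by (simp add: v_def)
  have vinc: "v k x \<le> v k' x" if "k \<le> k'" for k k' x
    using that u(1,4) unfolding v_def incseq_def le_fun_def by (auto simp: indicator_def)
  have vlim: "(\<lambda>k. v k x) \<longlonglongrightarrow> p x" for x
  proof -
    have "eventually (\<lambda>k. u k x = v k x) sequentially"
      using eventually_ge_at_top[of "nat \<lceil>norm x\<rceil>"]
      by eventually_elim (auto simp: v_def indicator_def)
    with ulim[of x] show ?thesis by (simp cong: tendsto_cong)
  qed
  have vp: "v k x \<le> p x" for k x
    by (rule incseq_le[OF _ vlim]) (auto simp: incseq_def vinc)
  have v1: "v k x \<le> 1" for k x using vp p(2) order_trans by blast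
  have vsf: "simple_function borel (v k)" for k
    unfolding v_def by (intro simple_function_mult simple_function_indicator u(2)) auto
  have [measurable]: "v k \<in> borel_measurable borel" for k
    using vsf by (rule borel_measurable_simple_function)
  have vsupp: "bounded {x. v k x \<noteq> 0}" for k
    by (rule bounded_subset[OF bounded_cball[of 0 "real k"]]) (auto simp: v_def indicator_def)
  define g where "g k w = (INF N. ennreal (\<Prod>n<N. 1 - v k (X n w)))" for k w
  have g_dec: "decseq g"
  proof (intro decseq_SucI le_funI)
    fix k w
    show "g (Suc k) w \<le> g k w"
      unfolding g_def by (intro INF_mono' ennreal_leI prod_mono) (simp add: vinc v1)
  qed
  \<comment> \<open>The empty product at \<open>N = 0\<close> gives the bound, which makes the
    integrals finite as decreasing convergence demands.\<close>
  have g_le: "g k w \<le> 1" for k w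
    unfolding g_def by (rule INF_lower2[of 0]) auto
  have "(\<integral>\<^sup>+w. (INF N. ennreal (\<Prod>n<N. 1 - p (X n w))) \<partial>P) = (\<integral>\<^sup>+w. (INF k. g k w) \<partial>P)"
  proof (intro nn_integral_cong)
    fix w
    \<comment> \<open>The limit in \<open>k\<close> is taken in a product of fixed finite length;
      the infimum over the length is exchanged afterwards.\<close>
    have "ennreal (\<Prod>n<N. 1 - p (X n w)) = (INF k. ennreal (\<Prod>n<N. 1 - v k (X n w)))" for N
    proof (rule LIMSEQ_unique)
      show "(\<lambda>k. ennreal (\<Prod>n<N. 1 - v k (X n w))) \<longlonglongrightarrow> ennreal (\<Prod>n<N. 1 - p (X n w))"
        by (intro tendsto_ennrealI tendsto_prod tendsto_diff tendsto_const vlim)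
      show "(\<lambda>k. ennreal (\<Prod>n<N. 1 - v k (X n w))) \<longlonglongrightarrow> (INF k. ennreal (\<Prod>n<N. 1 - v k (X n w)))"
        by (intro LIMSEQ_INF) (auto simp: decseq_def vinc v1 intro!: ennreal_leI prod_mono)
    qed
    then show "(INF N. ennreal (\<Prod>n<N. 1 - p (X n w))) = (INF k. g k w)"
      unfolding g_def by (subst INF_commute) simp
  qed
  also have "\<dots> = (INF k. \<integral>\<^sup>+w. g k w \<partial>P)"
  proof (rule nn_integral_monotone_convergence_INF_decseq[OF g_dec])
    show "g k \<in> borel_measurable P" for k unfolding g_def by measurable
    have "(\<integral>\<^sup>+w. g 0 w \<partial>P) \<le> (\<integral>\<^sup>+w. 1 \<partial>P)" by (intro nn_integral_mono g_le)
    then show "(\<integral>\<^sup>+w. g 0 w \<partial>P) < \<infinity>" by (simp add: emeasure_space_1 order_le_less_trans)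
  qed
  also have "\<dots> = (INF k. ennreal (exp (- (lam * integral\<^sup>L lborel (v k)))))"
    unfolding g_def
    by (subst nn_integral_INF_prod_simple[OF \<open>prob_space P\<close> ppp lam vsf v0 v1 vsupp]) simp
  also have "\<dots> = ennreal (exp (- (lam * integral\<^sup>L lborel p)))"
  proof (rule LIMSEQ_unique)
    have intv: "integrable lborel (v k)" for k
      by (rule Bochner_Integration.integrable_bound[OF int]) (auto simp: v0 vp p)
    have "(\<lambda>k. integral\<^sup>L lborel (v k)) \<longlonglongrightarrow> integral\<^sup>L lborel p"
      by (rule integral_dominated_convergence[of _ _ _ p]) (auto simp: int vlim v0 vp)
    then show "(\<lambda>k. ennreal (exp (- (lam * integral\<^sup>L lborel (v k)))))
        \<longlonglongrightarrow> ennreal (exp (- (lam * integral\<^sup>L lborel p)))"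
      by (intro tendsto_ennrealI tendsto_exp tendsto_minus tendsto_mult tendsto_const)
    show "(\<lambda>k. ennreal (exp (- (lam * integral\<^sup>L lborel (v k)))))
        \<longlonglongrightarrow> (INF k. ennreal (exp (- (lam * integral\<^sup>L lborel (v k)))))"
      using lam by (intro LIMSEQ_INF)
        (auto simp: decseq_def intro!: ennreal_leI mult_left_mono integral_mono intv vinc)
  qed
  finally show ?thesis .
qed

subsection \<open>Independence\<close>

text \<open>The diagonal map pushes \<open>M\<close> to the product of its restrictions to the two independent
  \<open>\<sigma>\<close>-algebras, so the two occurrences of the sample point may be integrated separately.\<close>

lemma (in prob_space) emeasure_indep_fubini:
  assumes A: "space A = space M" "sets A \<subseteq> events" and B: "space B = space M" "sets B \<subseteq> events"
    and ind: "indep_set (sets A) (sets B)"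
    and R: "Measurable.pred (A \<Otimes>\<^sub>M B) (\<lambda>x. R (fst x) (snd x))"
  shows "emeasure M {w \<in> space M. R w w} = (\<integral>\<^sup>+w. emeasure M {w' \<in> space M. R w w'} \<partial>M)"
proof -
  have idA [measurable]: "(\<lambda>w. w) \<in> measurable M A"
    using A by (auto intro!: measurableI)
  have idB [measurable]: "(\<lambda>w. w) \<in> measurable M B"
    using B by (auto intro!: measurableI)
  define MA MB where "MA = distr M A (\<lambda>w. w)" and "MB = distr M B (\<lambda>w. w)"
  interpret MA: prob_space MA unfolding MA_def by (rule prob_space_distr) measurable
  interpret MB: prob_space MB unfolding MB_def by (rule prob_space_distr) measurable
  have emA: "emeasure MA a = emeasure M a" if "a \<in> sets A" for a
    using that sets.sets_into_space[OF that] A unfolding MA_def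
    by (subst emeasure_distr) (auto intro!: arg_cong[where f = "emeasure M"])
  have emB: "emeasure MB b = emeasure M b" if "b \<in> sets B" for b
    using that sets.sets_into_space[OF that] B unfolding MB_def
    by (subst emeasure_distr) (auto intro!: arg_cong[where f = "emeasure M"])
  have sAB [measurable_cong]: "sets MA = sets A" "sets MB = sets B" by (simp_all add: MA_def MB_def)
  \<comment> \<open>On rectangles the equality of the two measures is exactly the independence of
    \<open>A\<close> and \<open>B\<close>.\<close>
  have prod: "MA \<Otimes>\<^sub>M MB = distr M (A \<Otimes>\<^sub>M B) (\<lambda>w. (w, w))"
  proof (rule pair_measure_eqI)
    show "sets (MA \<Otimes>\<^sub>M MB) = sets (distr M (A \<Otimes>\<^sub>M B) (\<lambda>w. (w, w)))"
      by (simp add: sets_pair_measure_cong[OF sAB])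
    fix a b assume "a \<in> sets MA" "b \<in> sets MB"
    then have ab [measurable]: "a \<in> sets A" "b \<in> sets B" by (simp_all add: sAB)
    have "emeasure (distr M (A \<Otimes>\<^sub>M B) (\<lambda>w. (w, w))) (a \<times> b) = emeasure M (a \<inter> b)"
      using sets.sets_into_space[OF ab(1)] A
      by (subst emeasure_distr) (auto intro!: arg_cong[where f = "emeasure M"])
    also have "\<dots> = emeasure M a * emeasure M b"
      using indep_setD[OF ind ab] by (simp add: emeasure_eq_measure ennreal_mult)
    finally show "emeasure MA a * emeasure MB b = emeasure (distr M (A \<Otimes>\<^sub>M B) (\<lambda>w. (w, w))) (a \<times> b)"
      by (simp add: emA[OF ab(1)] emB[OF ab(2)])
  qed unfold_locales
  define S where "S = {x \<in> space (A \<Otimes>\<^sub>M B). R (fst x) (snd x)}"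
  have S [measurable]: "S \<in> sets (A \<Otimes>\<^sub>M B)"
    using R by (simp add: S_def pred_def)
  have "emeasure M {w \<in> space M. R w w} = emeasure (distr M (A \<Otimes>\<^sub>M B) (\<lambda>w. (w, w))) S"
    using A B by (subst emeasure_distr[OF _ S])
      (auto simp: S_def space_pair_measure intro!: arg_cong[where f = "emeasure M"])
  also have "\<dots> = (\<integral>\<^sup>+w. emeasure MB (Pair w -` S) \<partial>MA)"
    unfolding prod[symmetric] by (rule MB.emeasure_pair_measure_alt) measurable
  also have "\<dots> = (\<integral>\<^sup>+w. emeasure MB (Pair w -` S) \<partial>M)"
    unfolding MA_def
  proof (subst nn_integral_distr)
    have "(\<lambda>w. emeasure MB (Pair w -` S)) \<in> borel_measurable MA"
      by (rule MB.measurable_emeasure_Pair) measurable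
    then show "(\<lambda>w. emeasure MB (Pair w -` S)) \<in> borel_measurable (distr M A (\<lambda>w. w))"
      unfolding MA_def .
  qed (auto simp: idA)
  also have "\<dots> = (\<integral>\<^sup>+w. emeasure M {w' \<in> space M. R w w'} \<partial>M)"
  proof (rule nn_integral_cong)
    fix w assume w: "w \<in> space M"
    have "Pair w -` S \<in> sets B" using S by (rule sets_Pair1)
    then have "emeasure MB (Pair w -` S) = emeasure M (Pair w -` S)" by (rule emB)
    moreover have "Pair w -` S = {w' \<in> space M. R w w'}"
      using w A B by (auto simp: S_def space_pair_measure)
    ultimately show "emeasure MB (Pair w -` S) = emeasure M {w' \<in> space M. R w w'}" by simp
  qed
  finally show ?thesis .
qed

context radar_network
begin

section \<open>Blocks of independent sources of randomness\<close>

definition source_algebra :: "randomness \<Rightarrow> 'w set set" where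
  "source_algebra s = (case s of
      Locations \<Rightarrow> sets (vimage_algebra (space P) (\<lambda>w n. X n w) (\<Pi>\<^sub>M n\<in>UNIV. borel))
    | Slot_Mark d \<Rightarrow> sets (vimage_algebra (space P) (mark d) (count_space UNIV))
    | Boresight d \<Rightarrow> sets (vimage_algebra (space P) (bore d) borel)
    | Fading_Coeff n \<Rightarrow> sets (vimage_algebra (space P) (zeta n) borel))"

text \<open>Serves as the measurable space of everything the sources in \<open>K\<close> determine,
  so that independence of events reduces to disjointness of index sets.\<close>

definition info :: "randomness set \<Rightarrow> 'w measure" where
  "info K = sigma (space P) (\<Union>s\<in>K. source_algebra s)"

lemma indep_source_algebra: "indep_sets source_algebra UNIV"
  using independent unfolding source_algebra_def .

lemma source_algebra_events: "source_algebra s \<subseteq> events"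
  using indep_source_algebra by (auto simp: indep_sets_def)

lemma source_algebra_Pow: "source_algebra s \<subseteq> Pow (space P)"
  using source_algebra_events sets.space_closed by blast

lemma space_info [simp]: "space (info K) = space P"
  by (simp add: info_def space_measure_of_conv)

lemma sets_info: "sets (info K) = sigma_sets (space P) (\<Union>s\<in>K. source_algebra s)"
  unfolding info_def using source_algebra_Pow by (intro sets_measure_of) blast

lemma sets_info_events: "sets (info K) \<subseteq> events"
  unfolding sets_info using source_algebra_events by (intro sets.sigma_sets_subset) blast

lemma source_algebra_info: "s \<in> K \<Longrightarrow> source_algebra s \<subseteq> sets (info K)"
  unfolding sets_info by auto

lemma measurable_info_P: "f \<in> measurable (info K) N \<Longrightarrow> f \<in> measurable P N"
  using sets_info_events by (auto simp: measurable_def)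

lemma Int_stable_source_algebra: "Int_stable (source_algebra s)"
  unfolding source_algebra_def Int_stable_def by (cases s) auto

text \<open>Grouping of independent families: each source algebra is closed under intersections, so
  disjoint blocks generate independent \<sigma>-algebras.\<close>

lemma indep_info:
  assumes "disjoint_family_on K J"
  shows "indep_sets (\<lambda>j. sets (info (K j))) J"
  unfolding sets_info
  by (intro indep_sets_collect_sigma indep_sets_mono_index[OF _ indep_source_algebra]
      Int_stable_source_algebra assms) auto

lemma indep_info_pair:
  assumes "K \<inter> L = {}"
  shows "indep_set (sets (info K)) (sets (info L))"
proof -
  have "indep_sets (\<lambda>j. sets (info (case_bool K L j))) UNIV"
    using assms by (intro indep_info) (auto simp: disjoint_family_on_def split: bool.split)
  also have "(\<lambda>j. sets (info (case_bool K L j))) = case_bool (sets (info K)) (sets (info L))"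
    by (auto simp: fun_eq_iff split: bool.split)
  finally show ?thesis unfolding indep_set_def .
qed

lemma measurable_info_vimage:
  assumes "source_algebra s = sets (vimage_algebra (space P) f N)" "s \<in> K"
    and "f \<in> space P \<rightarrow> space N"
  shows "f \<in> measurable (info K) N"
  using source_algebra_info[OF assms(2)] assms(3) unfolding assms(1)
  by (intro measurableI) (auto simp: sets_vimage_algebra2)

lemma measurable_X_info:
  assumes "Locations \<in> K"
  shows "X n \<in> borel_measurable (info K)"
proof -
  have "(\<lambda>w n. X n w) \<in> measurable (info K) (\<Pi>\<^sub>M n\<in>UNIV. borel)"
    using assms by (intro measurable_info_vimage) (auto simp: source_algebra_def space_PiM)
  from measurable_compose[OF this measurable_component_singleton[of n UNIV]] show ?thesis by simp
qed

lemma measurable_mark_info: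
  "Slot_Mark d \<in> K \<Longrightarrow> mark d \<in> measurable (info K) (count_space UNIV)"
  by (rule measurable_info_vimage[of "Slot_Mark d"]) (auto simp: source_algebra_def)

lemma measurable_bore_info:
  "Boresight d \<in> K \<Longrightarrow> bore d \<in> borel_measurable (info K)"
  by (rule measurable_info_vimage[of "Boresight d"]) (auto simp: source_algebra_def)

lemma measurable_zeta_info:
  "Fading_Coeff n \<in> K \<Longrightarrow> zeta n \<in> borel_measurable (info K)"
  by (rule measurable_info_vimage[of "Fading_Coeff n"]) (auto simp: source_algebra_def)

lemma prob_conj_info:
  assumes "K \<inter> L = {}" "Measurable.pred (info K) Q" "Measurable.pred (info L) R"
  shows "prob {w \<in> space P. Q w \<and> R w} = prob {w \<in> space P. Q w} * prob {w \<in> space P. R w}"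
proof -
  have "{w \<in> space P. Q w} \<in> sets (info K)" "{w \<in> space P. R w} \<in> sets (info L)"
    using assms(2,3) by (simp_all add: pred_def)
  note indep_setD[OF indep_info_pair[OF assms(1)] this]
  moreover have "{w \<in> space P. Q w \<and> R w} = {w \<in> space P. Q w} \<inter> {w \<in> space P. R w}"
    by auto
  ultimately show ?thesis by simp
qed

lemma emeasure_info_fubini:
  assumes "K \<inter> L = {}" "Measurable.pred (info K \<Otimes>\<^sub>M info L) (\<lambda>x. R (fst x) (snd x))"
  shows "emeasure P {w \<in> space P. R w w} = (\<integral>\<^sup>+w. emeasure P {w' \<in> space P. R w w'} \<partial>P)"
  by (rule emeasure_indep_fubini[OF _ _ _ _ indep_info_pair assms(2)])
     (use assms(1) sets_info_events in auto)

text \<open>Continuity from above reduces the event to finitely many indices, where independence of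
  the blocks gives a product.\<close>

lemma emeasure_all_info:
  assumes disj: "disjoint_family K"
    and Q: "\<And>n :: nat. Measurable.pred (info (K n)) (Q n)"
  shows "emeasure P {w \<in> space P. \<forall>n. Q n w} = (INF N. ennreal (\<Prod>n<N. prob {w \<in> space P. Q n w}))"
proof -
  have Q': "{w \<in> space P. Q n w} \<in> sets (info (K n))" for n
    using Q[of n] by (simp add: pred_def)
  have [measurable]: "{w \<in> space P. Q n w} \<in> events" for n
    using Q' sets_info_events by blast
  have fin: "prob {w \<in> space P. \<forall>n<N. Q n w} = (\<Prod>n<N. prob {w \<in> space P. Q n w})" for N
  \<comment> \<open>Independence speaks of nonempty finite index sets, so the empty intersection is
    treated apart.\<close>
  proof (cases "N = 0")
    case True
    then show ?thesis by (simp add: prob_space)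
  next
    case False
    then have "{w \<in> space P. \<forall>n<N. Q n w} = (\<Inter>n\<in>{..<N}. {w \<in> space P. Q n w})" by auto
    also have "prob \<dots> = (\<Prod>n<N. prob {w \<in> space P. Q n w})"
      using False by (intro indep_setsD[OF indep_info[OF disj]]) (auto simp: Q')
    finally show ?thesis .
  qed
  have "{w \<in> space P. \<forall>n. Q n w} = (\<Inter>N. {w \<in> space P. \<forall>n<N. Q n w})"
    by auto
  also have "emeasure P \<dots> = (INF N. emeasure P {w \<in> space P. \<forall>n<N. Q n w})"
    by (intro INF_emeasure_decseq[symmetric]) (auto simp: decseq_def)
  finally show ?thesis by (simp add: emeasure_eq_measure fin)
qed

end

subsection \<open>Laws of the marks\<close>

context radar_network
begin

lemma mark_measurable' [measurable]: "mark d \<in> measurable P (count_space UNIV)"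
  by (rule mark_measurable)

lemma bore_measurable' [measurable]: "bore d \<in> borel_measurable P"
  by (rule bore_measurable)

lemma zeta_measurable [measurable]: "zeta n \<in> borel_measurable P"
  using measurable_info_P[OF measurable_zeta_info[of n UNIV]] by simp

lemma prob_transmits:
  assumes "0 < M"
  shows "prob {w \<in> space P. transmits M (mark d w) s} = 1 / M"
proof -
  \<comment> \<open>Each slot is served by exactly one mark, its residue modulo
    \<open>M\<close>.\<close>
  have eq: "{0..<M} \<inter> {m. transmits M m s} = {s mod M}"
    using assms by (auto simp: transmits_def) (metis div_mult_mod_eq add.commute)
  have "prob {w \<in> space P. transmits M (mark d w) s}
      = measure (distr P (count_space UNIV) (mark d)) {m. transmits M m s}"
    by (subst measure_distr) (auto simp: vimage_def Int_def conj_commute)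
  also have "\<dots> = 1 / M"
    using assms unfolding mark_uniform by (subst measure_pmf_of_set) (auto simp: eq)
  finally show ?thesis .
qed

lemma prob_boresight:
  assumes \<phi>: "0 < \<phi>" "\<phi> \<le> 2 * pi" and "v \<noteq> 0"
  shows "prob {w \<in> space P. v \<in> sector \<phi> (bore d w)} = \<phi> / (2 * pi)"
proof -
  have A [measurable]: "{\<theta>. v \<in> sector \<phi> \<theta>} \<in> sets borel"
    using measurable_mem_sector[OF \<phi>, of "\<lambda>_. v" borel "\<lambda>x. x"] unfolding pred_def by simp
  have "emeasure P {w \<in> space P. v \<in> sector \<phi> (bore d w)}
      = emeasure (distr P lborel (bore d)) {\<theta>. v \<in> sector \<phi> \<theta>}"
    by (subst emeasure_distr) (auto simp: vimage_def Int_def conj_commute)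
  also have "\<dots> = emeasure lborel ({0..<2 * pi} \<inter> {\<theta>. v \<in> sector \<phi> \<theta>}) / ennreal (2 * pi)"
    unfolding bore_uniform by (subst emeasure_uniform_measure) auto
  also have "{0..<2 * pi} \<inter> {\<theta>. v \<in> sector \<phi> \<theta>} = {\<theta> \<in> {0..<2 * pi}. v \<in> sector \<phi> \<theta>}"
    by auto
  also have "emeasure lborel \<dots> / ennreal (2 * pi) = ennreal (\<phi> / (2 * pi))"
    unfolding emeasure_boresights[OF assms] using \<phi> by (simp add: divide_ennreal)
  finally show ?thesis using \<phi> by (simp add: emeasure_eq_measure)
qed

text \<open>Makes the exceedance probability a single function of the location, the same for all
  devices, as the generating functional requires.\<close>

lemma prob_zeta_eq: "prob {w \<in> space P. t < zeta n w} = prob {w \<in> space P. t < zeta k w}"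
proof (cases fad)
  case No_Fading
  then have "zeta n w = zeta k w" if "w \<in> space P" for w
    using zeta_law[of n] zeta_law[of k] that by simp
  then show ?thesis by (metis (mono_tags, lifting))
next
  case Rayleigh
  have "prob {w \<in> space P. t < zeta n w} = measure (distr P lborel (zeta n)) {t<..}" for n
    by (subst measure_distr) (auto simp: vimage_def Int_def conj_commute)
  moreover have "distr P lborel (zeta n) = distr P lborel (zeta k)"
    using zeta_law[of n] zeta_law[of k] Rayleigh by (simp add: distributed_def)
  ultimately show ?thesis by simp
qed

text \<open>The source of the factor \<Omega>: under Rayleigh fading the moment is Euler's integral
  for Gamma. The coefficient has its law but no pointwise sign, whence the truncation
  \<open>max 0\<close>.\<close>

lemma nn_integral_zeta_powr:
  assumes "0 < \<alpha>"
  shows "(\<integral>\<^sup>+w. ennreal (max 0 (zeta n w) powr (2 / \<alpha>)) \<partial>P) = ennreal (fading_factor fad \<alpha>)"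
proof (cases fad)
  case No_Fading
  then have "zeta n w = 1" if "w \<in> space P" for w
    using zeta_law[of n] that by simp
  then have "(\<integral>\<^sup>+w. ennreal (max 0 (zeta n w) powr (2 / \<alpha>)) \<partial>P) = (\<integral>\<^sup>+w. 1 \<partial>P)"
    by (intro nn_integral_cong) simp
  then show ?thesis using No_Fading by (simp add: fading_factor_def emeasure_space_1)
next
  case Rayleigh
  then have d: "distributed P lborel (zeta n) (\<lambda>x. ennreal (exponential_density 1 x))"
    using zeta_law[of n] by simp
  have "(\<integral>\<^sup>+w. ennreal (max 0 (zeta n w) powr (2 / \<alpha>)) \<partial>P)
      = (\<integral>\<^sup>+x. ennreal (exponential_density 1 x) * ennreal (max 0 x powr (2 / \<alpha>)) \<partial>lborel)"
    by (subst distributed_nn_integral[OF d, symmetric]) auto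
  also have "\<dots> = (\<integral>\<^sup>+t. ennreal (indicator {0..} t * t powr (1 + 2 / \<alpha> - 1) / exp t) \<partial>lborel)"
    by (intro nn_integral_cong)
       (auto simp: exponential_density_def indicator_def exp_minus field_simps simp flip: ennreal_mult)
  also have "\<dots> = ennreal (Gamma (1 + 2 / \<alpha>))"
    using assms by (intro Gamma_conv_nn_integral_real[symmetric]) (simp add: add_pos_pos)
  finally show ?thesis using Rayleigh by (simp add: fading_factor_def)
qed

end

subsection \<open>The strongest interferer\<close>

lemma measurable_received_power:
  assumes \<phi>: "0 < \<phi>" "\<phi> \<le> 2 * pi"
    and [measurable]: "r \<in> borel_measurable N" "t \<in> borel_measurable N" "z \<in> borel_measurable N"
      "x \<in> borel_measurable N"
  shows "(\<lambda>w. received_power Pt Gm l \<phi> \<alpha> (r w) (t w) (z w) (x w)) \<in> borel_measurable N"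
proof -
  have [measurable]: "Measurable.pred N (\<lambda>w. 0 - x w \<in> sector \<phi> (t w))"
      "Measurable.pred N (\<lambda>w. x w - 0 \<in> sector \<phi> (r w))"
    by (rule measurable_mem_sector[OF \<phi>]; measurable)+
  show ?thesis unfolding received_power_def cone_gain_def by measurable
qed

text \<open>Solves the exceedance condition for the distance. For \<open>z \<le> 0\<close> no point
  qualifies, in agreement with the empty open ball of radius 0.\<close>

lemma powr_less_iff_mem_ball:
  fixes x :: "'a::real_normed_vector"
  assumes "0 < c" "0 < \<alpha>"
  shows "c * norm x powr \<alpha> < z \<longleftrightarrow> x \<in> ball 0 ((max 0 z / c) powr (1 / \<alpha>))"
proof (cases "0 < z")
  case True
  have "norm x < (z / c) powr (1 / \<alpha>) \<longleftrightarrow> norm x powr \<alpha> < ((z / c) powr (1 / \<alpha>)) powr \<alpha>"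
    using assms by (metis norm_ge_zero powr_ge_zero powr_less_mono2 powr_mono2 not_less less_imp_le)
  also have "((z / c) powr (1 / \<alpha>)) powr \<alpha> = z / c"
    using assms True by (simp add: powr_powr)
  finally show ?thesis using True assms by (simp add: field_simps)
next
  case False
  then have "\<not> c * norm x powr \<alpha> < z" using assms
    by (metis less_le_trans mult_nonneg_nonneg not_less order_less_imp_le powr_ge_zero)
  then show ?thesis using False by simp
qed

lemma fading_factor_nonneg: "0 < \<alpha> \<Longrightarrow> 0 \<le> fading_factor fad \<alpha>"
  by (cases fad) (auto simp: fading_factor_def add_pos_pos intro!: less_imp_le Gamma_real_pos)

locale radar_detection = radar_network P lam M fad X mark bore zeta
  for P :: "'w measure" and lam M fad X mark bore zeta +
  fixes s :: nat and Pt Gm l \<phi> \<alpha> i :: real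
  assumes pos: "0 < lam" "0 < M" "0 < Pt" "0 < Gm" "0 < l" "0 < i" "0 < \<alpha>"
    and \<phi>: "0 < \<phi>" "\<phi> \<le> 2 * pi"
begin

section \<open>Exceedance by a single device\<close>

text \<open>The arguments are plain values, so that any of them can be frozen while the others are
  random.\<close>

definition exceeds :: "real \<Rightarrow> real ^ 2 \<Rightarrow> nat \<Rightarrow> real \<Rightarrow> real \<Rightarrow> bool" where
  "exceeds \<theta> x m t z \<longleftrightarrow> transmits M m s \<and> i < received_power Pt Gm l \<phi> \<alpha> \<theta> t z x"

abbreviation device_exceeds :: "real \<Rightarrow> real ^ 2 \<Rightarrow> nat \<Rightarrow> 'w \<Rightarrow> bool" where
  "device_exceeds \<theta> x n w \<equiv> exceeds \<theta> x (mark (Other n) w) (bore (Other n) w) (zeta n w)"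

lemma measurable_exceeds [measurable (raw)]:
  assumes [measurable]: "\<theta> \<in> borel_measurable N" "x \<in> borel_measurable N"
    "m \<in> measurable N (count_space UNIV)" "t \<in> borel_measurable N" "z \<in> borel_measurable N"
  shows "Measurable.pred N (\<lambda>w. exceeds (\<theta> w) (x w) (m w) (t w) (z w))"
proof -
  note [measurable] = measurable_received_power[OF \<phi>]
  show ?thesis unfolding exceeds_def by measurable
qed

text \<open>The fading value that an active device at unit distance must pass when both beams are
  aligned; it equals i / \<omega>.\<close>

abbreviation "threshold \<equiv> i / (Pt * Gm\<^sup>2 * l)"

text \<open>With either gain zero the power is 0, below the positive level. At the origin the
  equivalence can fail: the received power is 0 there, while the right side asks only for
  \<open>0 < z\<close>.\<close>

lemma exceeds_iff:
  assumes "x \<noteq> 0"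
  shows "exceeds \<theta> x m t z \<longleftrightarrow>
    transmits M m s \<and> - x \<in> sector \<phi> t \<and> x \<in> sector \<phi> \<theta> \<and> threshold * norm x powr \<alpha> < z"
proof -
  have "i < Pt * Gm * Gm * l * z * norm x powr (- \<alpha>) \<longleftrightarrow> threshold * norm x powr \<alpha> < z"
    using pos assms by (simp add: powr_minus field_simps power2_eq_square)
  then show ?thesis
    using pos by (auto simp: exceeds_def received_power_def cone_gain_def)
qed

lemma not_exceeds_0: "\<not> exceeds \<theta> 0 m t z"
  using pos by (simp add: exceeds_def received_power_def)

lemma strongest_interferer_le_iff:
  "strongest_interferer Pt Gm l \<phi> \<alpha> M X mark bore zeta s w \<le> ennreal i \<longleftrightarrow>
    (\<forall>n. \<not> device_exceeds (bore Typical w) (X n w) n w)"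
  using pos by (auto simp: strongest_interferer_def SUP_le_iff exceeds_def ennreal_le_iff not_less)

text \<open>The function \<open>p\<close> of the generating functional. Its factors stand for the
  slot, the device's beam, the receiver's beam and the fading, with \<open>zeta 0\<close>
  representing the common law; the origin is cut out because \<open>received_power\<close> is 0
  there.\<close>

definition exceed_prob :: "real \<Rightarrow> real ^ 2 \<Rightarrow> real" where
  "exceed_prob \<theta> x = 1 / M * (\<phi> / (2 * pi)) *
     (indicator (sector \<phi> \<theta> - {0}) x * prob {w \<in> space P. threshold * norm x powr \<alpha> < zeta 0 w})"

text \<open>The location is left out, since all locations together form one source.\<close>

definition node :: "nat \<Rightarrow> randomness set" where
  "node n = {Slot_Mark (Other n), Boresight (Other n), Fading_Coeff n}"

lemma measurable_node:
  assumes "node n \<subseteq> K"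
  shows "mark (Other n) \<in> measurable (info K) (count_space UNIV)"
    "bore (Other n) \<in> borel_measurable (info K)"
    "zeta n \<in> borel_measurable (info K)"
  using assms
  by (auto simp: node_def intro!: measurable_mark_info measurable_bore_info measurable_zeta_info)

lemma prob_exceeds:
  "prob {w \<in> space P. device_exceeds \<theta> x n w} = exceed_prob \<theta> x"
proof (cases "x \<in> sector \<phi> \<theta> - {0}")
  case True
  have [measurable]: "mark (Other n) \<in> measurable (info {Slot_Mark (Other n)}) (count_space UNIV)"
    "bore (Other n) \<in> borel_measurable (info {Boresight (Other n)})"
    "bore (Other n) \<in> borel_measurable (info {Boresight (Other n), Fading_Coeff n})"
    "zeta n \<in> borel_measurable (info {Boresight (Other n), Fading_Coeff n})"
    "zeta n \<in> borel_measurable (info {Fading_Coeff n})"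
    by (simp_all add: measurable_mark_info measurable_bore_info measurable_zeta_info)
  note [measurable] = measurable_mem_sector[OF \<phi>]
  have "prob {w \<in> space P. device_exceeds \<theta> x n w}
      = prob {w \<in> space P. transmits M (mark (Other n) w) s \<and>
          (- x \<in> sector \<phi> (bore (Other n) w) \<and> threshold * norm x powr \<alpha> < zeta n w)}"
    using True by (intro arg_cong[where f = prob]) (auto simp: exceeds_iff)
  also have "\<dots> = prob {w \<in> space P. transmits M (mark (Other n) w) s} *
      prob {w \<in> space P. - x \<in> sector \<phi> (bore (Other n) w) \<and> threshold * norm x powr \<alpha> < zeta n w}"
    by (rule prob_conj_info[of "{Slot_Mark (Other n)}" "{Boresight (Other n), Fading_Coeff n}"])
       (simp, measurable)
  also have "prob {w \<in> space P. - x \<in> sector \<phi> (bore (Other n) w) \<and> threshold * norm x powr \<alpha> < zeta n w}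
      = prob {w \<in> space P. - x \<in> sector \<phi> (bore (Other n) w)} *
        prob {w \<in> space P. threshold * norm x powr \<alpha> < zeta n w}"
    by (rule prob_conj_info[of "{Boresight (Other n)}" "{Fading_Coeff n}"]) (simp, measurable)
  also have "prob {w \<in> space P. threshold * norm x powr \<alpha> < zeta n w}
      = prob {w \<in> space P. threshold * norm x powr \<alpha> < zeta 0 w}"
    by (rule prob_zeta_eq)
  finally show ?thesis
    using True pos prob_boresight[OF \<phi>, of "- x"] by (simp add: prob_transmits exceed_prob_def)
next
  case False
  then have empty: "{w \<in> space P. device_exceeds \<theta> x n w} = {}"
    by (cases "x = 0") (auto simp: exceeds_iff not_exceeds_0)
  show ?thesis unfolding empty using False by (simp add: exceed_prob_def)
qed

lemma measurable_exceed_prob [measurable]: "exceed_prob \<theta> \<in> borel_measurable borel"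
proof -
  note [measurable] = sets_sector[OF \<phi>]
  show ?thesis unfolding exceed_prob_def by measurable
qed

lemma exceed_prob_bounds: "0 \<le> exceed_prob \<theta> x" "exceed_prob \<theta> x \<le> 1"
  unfolding prob_exceeds[of \<theta> x 0, symmetric] by simp_all

text \<open>Tonelli brings the fading outside. For a fixed coefficient the region is a sector of a
  disc whose squared radius is proportional to its power \<open>2 / \<alpha>\<close>, so a moment of
  the fading remains, and no trace of \<open>\<theta>\<close>.\<close>

lemma nn_integral_exceed_prob:
  "(\<integral>\<^sup>+x. ennreal (exceed_prob \<theta> x) \<partial>lborel)
    = ennreal (\<phi>\<^sup>2 * fading_factor fad \<alpha> * threshold powr (- 2 / \<alpha>) / (4 * pi * M))"
proof -
  define c where "c = threshold"
  have c: "0 < c" using pos by (simp add: c_def)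
  note [measurable] = sets_sector[OF \<phi>]
  interpret pair_sigma_finite lborel P ..
  define h where "h x = (\<integral>\<^sup>+w. indicator (sector \<phi> \<theta>) x *
      indicator {w \<in> space P. c * norm x powr \<alpha> < zeta 0 w} w \<partial>P)" for x :: "real ^ 2"
  have h: "h x = indicator (sector \<phi> \<theta>) x * emeasure P {w \<in> space P. c * norm x powr \<alpha> < zeta 0 w}"
    for x unfolding h_def by (subst nn_integral_cmult_indicator) auto
  have "(\<integral>\<^sup>+x. ennreal (exceed_prob \<theta> x) \<partial>lborel)
      = (\<integral>\<^sup>+x. ennreal (1 / M * (\<phi> / (2 * pi))) * h x \<partial>lborel)"
  proof (intro nn_integral_cong_AE)
    have "AE x in lborel. x \<noteq> (0 :: real ^ 2)" by (rule AE_lborel_singleton)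
    then show "AE x in lborel. ennreal (exceed_prob \<theta> x) = ennreal (1 / M * (\<phi> / (2 * pi))) * h x"
    proof eventually_elim
      case (elim x)
      then have "exceed_prob \<theta> x = 1 / M * (\<phi> / (2 * pi)) *
          (indicator (sector \<phi> \<theta>) x * prob {w \<in> space P. c * norm x powr \<alpha> < zeta 0 w})"
        by (simp add: exceed_prob_def c_def indicator_def)
      also have "ennreal \<dots> = ennreal (1 / M * (\<phi> / (2 * pi))) * h x"
        unfolding h using \<phi> by (subst ennreal_mult) (auto simp: emeasure_eq_measure ennreal_mult indicator_def)
      finally show ?case .
    qed
  qed
  also have "\<dots> = ennreal (1 / M * (\<phi> / (2 * pi))) * (\<integral>\<^sup>+x. h x \<partial>lborel)"
    unfolding h_def by (rule nn_integral_cmult) measurable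
  also have "(\<integral>\<^sup>+x. h x \<partial>lborel) = (\<integral>\<^sup>+w. \<integral>\<^sup>+x. indicator (sector \<phi> \<theta>) x *
      indicator {w \<in> space P. c * norm x powr \<alpha> < zeta 0 w} w \<partial>lborel \<partial>P)"
    unfolding h_def by (rule Fubini'[symmetric]) measurable
  also have "\<dots> = (\<integral>\<^sup>+w. ennreal (\<phi> / 2 * c powr (- 2 / \<alpha>)) * ennreal (max 0 (zeta 0 w) powr (2 / \<alpha>)) \<partial>P)"
  proof (rule nn_integral_cong)
    fix w assume w: "w \<in> space P"
    define R where "R = (max 0 (zeta 0 w) / c) powr (1 / \<alpha>)"
    have "(\<integral>\<^sup>+x. indicator (sector \<phi> \<theta>) x *
        indicator {w \<in> space P. c * norm x powr \<alpha> < zeta 0 w} w \<partial>lborel)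
      = (\<integral>\<^sup>+x. indicator (sector \<phi> \<theta> \<inter> ball 0 R) x \<partial>lborel)"
      using w powr_less_iff_mem_ball[OF c pos(7), of _ "zeta 0 w"]
      by (intro nn_integral_cong) (auto simp: indicator_def R_def)
    also have "\<dots> = ennreal (\<phi> / 2 * R\<^sup>2)"
      using emeasure_sector_disc[OF \<phi>, of R \<theta>] by (simp add: R_def)
    also have "R\<^sup>2 = (max 0 (zeta 0 w) / c) powr (2 / \<alpha>)"
      by (simp add: R_def power2_eq_square flip: powr_add)
    also have "\<dots> = c powr (- 2 / \<alpha>) * max 0 (zeta 0 w) powr (2 / \<alpha>)"
      using c by (simp add: powr_divide powr_minus_divide)
    finally show "(\<integral>\<^sup>+x. indicator (sector \<phi> \<theta>) x *
        indicator {w \<in> space P. c * norm x powr \<alpha> < zeta 0 w} w \<partial>lborel)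
      = ennreal (\<phi> / 2 * c powr (- 2 / \<alpha>)) * ennreal (max 0 (zeta 0 w) powr (2 / \<alpha>))"
      using \<phi> by (simp add: mult.assoc flip: ennreal_mult)
  qed
  also have "\<dots> = ennreal (\<phi> / 2 * c powr (- 2 / \<alpha>)) * ennreal (fading_factor fad \<alpha>)"
    by (subst nn_integral_cmult) (use nn_integral_zeta_powr[OF pos(7)] in auto)
  also have "ennreal (1 / M * (\<phi> / (2 * pi))) * \<dots>
      = ennreal (1 / M * (\<phi> / (2 * pi)) * (\<phi> / 2 * c powr (- 2 / \<alpha>) * fading_factor fad \<alpha>))"
    using \<phi> fading_factor_nonneg[OF pos(7)] by (simp add: mult.assoc flip: ennreal_mult)
  also have "1 / M * (\<phi> / (2 * pi)) * (\<phi> / 2 * c powr (- 2 / \<alpha>) * fading_factor fad \<alpha>)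
      = \<phi>\<^sup>2 * fading_factor fad \<alpha> * c powr (- 2 / \<alpha>) / (4 * pi * M)"
    by (simp add: power2_eq_square ac_simps)
  finally show ?thesis by (simp add: c_def)
qed

section \<open>From frozen locations to the whole network\<close>

text \<open>With locations and receiver boresight frozen, device \<open>n\<close> depends on
  \<open>node n\<close> alone, and these blocks are disjoint.\<close>

lemma emeasure_no_exceed_at:
  "emeasure P {w \<in> space P. \<forall>n. \<not> device_exceeds \<theta> (x n) n w}
    = (INF N. ennreal (\<Prod>n<N. 1 - exceed_prob \<theta> (x n)))"
proof -
  note [measurable] = measurable_node[OF order_refl]
  have "emeasure P {w \<in> space P. \<forall>n. \<not> device_exceeds \<theta> (x n) n w}
    = (INF N. ennreal (\<Prod>n<N. prob {w \<in> space P.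
          \<not> device_exceeds \<theta> (x n) n w}))"
  proof (rule emeasure_all_info[of node])
    show "disjoint_family node" by (auto simp: disjoint_family_on_def node_def)
  qed measurable
  moreover have "prob {w \<in> space P. \<not> device_exceeds \<theta> (x n) n w}
      = 1 - exceed_prob \<theta> (x n)" for n
    unfolding prob_exceeds[of \<theta> "x n" n, symmetric] by (rule prob_neg) measurable
  ultimately show ?thesis by simp
qed

lemma emeasure_no_exceed_direction:
  "emeasure P {w \<in> space P. \<forall>n. \<not> device_exceeds \<theta> (X n w) n w}
    = ennreal (exp (- (lam * (\<phi>\<^sup>2 * fading_factor fad \<alpha> * threshold powr (- 2 / \<alpha>) / (4 * pi * M)))))"
proof -
  define K where "K = {Locations}"
  define L where "L = (\<Union>n. node n)"
  have [measurable]: "X n \<in> borel_measurable (info K)" for n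
    by (rule measurable_X_info) (simp add: K_def)
  have "node n \<subseteq> L" for n by (auto simp: L_def)
  note [measurable] = measurable_node[OF this]
  have "emeasure P {w \<in> space P. \<forall>n. \<not> device_exceeds \<theta> (X n w) n w}
    = (\<integral>\<^sup>+w. emeasure P {w' \<in> space P.
        \<forall>n. \<not> device_exceeds \<theta> (X n w) n w'} \<partial>P)"
  proof (rule emeasure_info_fubini[of K L])
    show "K \<inter> L = {}" by (auto simp: K_def L_def node_def)
  qed measurable
  also have "\<dots> = (\<integral>\<^sup>+w. (INF N. ennreal (\<Prod>n<N. 1 - exceed_prob \<theta> (X n w))) \<partial>P)"
    by (simp only: emeasure_no_exceed_at)
  also have "\<dots> = ennreal (exp (- (lam * integral\<^sup>L lborel (exceed_prob \<theta>))))"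
  proof (rule nn_integral_INF_prod_Poisson[OF _ ppp])
    show "integrable lborel (exceed_prob \<theta>)"
      using nn_integral_exceed_prob[of \<theta>] exceed_prob_bounds by (intro integrableI_nonneg) auto
  qed (use pos exceed_prob_bounds prob_space_axioms in auto)
  also have "integral\<^sup>L lborel (exceed_prob \<theta>)
      = \<phi>\<^sup>2 * fading_factor fad \<alpha> * threshold powr (- 2 / \<alpha>) / (4 * pi * M)"
    using exceed_prob_bounds fading_factor_nonneg[OF pos(7)]
    by (subst integral_eq_nn_integral) (auto simp: nn_integral_exceed_prob)
  finally show ?thesis .
qed

text \<open>The receiver's boresight is released last: the inner probability does not depend on it,
  so the outer integral is that of a constant.\<close>

lemma prob_no_exceed:
  "prob {w \<in> space P. \<forall>n. \<not> device_exceeds (bore Typical w) (X n w) n w}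
    = exp (- (lam * (\<phi>\<^sup>2 * fading_factor fad \<alpha> * threshold powr (- 2 / \<alpha>) / (4 * pi * M))))"
proof -
  define K where "K = {Boresight Typical}"
  define L where "L = - K"
  have [measurable]: "bore Typical \<in> borel_measurable (info K)" "X n \<in> borel_measurable (info L)" for n
    by (auto simp: K_def L_def intro!: measurable_X_info measurable_bore_info)
  have "node n \<subseteq> L" for n by (auto simp: K_def L_def node_def)
  note [measurable] = measurable_node[OF this]
  have "emeasure P {w \<in> space P. \<forall>n. \<not> device_exceeds (bore Typical w) (X n w) n w}
    = (\<integral>\<^sup>+w. emeasure P {w' \<in> space P.
        \<forall>n. \<not> device_exceeds (bore Typical w) (X n w') n w'} \<partial>P)"
  proof (rule emeasure_info_fubini[of K L])
    show "K \<inter> L = {}" by (simp add: L_def)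
  qed measurable
  also have "\<dots> = ennreal (exp (- (lam * (\<phi>\<^sup>2 * fading_factor fad \<alpha> * threshold powr (- 2 / \<alpha>) / (4 * pi * M)))))"
    unfolding emeasure_no_exceed_direction by (simp add: emeasure_space_1)
  finally show ?thesis by (simp add: emeasure_eq_measure)
qed

text \<open>The receiver's own mark affects no interferer, so conditioning on a detection slot
  cancels. With \<open>2 \<le> M\<close> that event has the positive probability
  \<open>1 - 1 / M\<close>, which the quotient in \<open>cond_prob\<close> needs.\<close>

lemma cond_prob_strongest_interferer:
  assumes "2 \<le> M"
  shows "\<P>(w in P. strongest_interferer Pt Gm l \<phi> \<alpha> M X mark bore zeta s w \<le> ennreal i
      \<bar> \<not> transmits M (mark Typical w) s)
    = exp (- (lam * (\<phi>\<^sup>2 * fading_factor fad \<alpha> * threshold powr (- 2 / \<alpha>) / (4 * pi * M))))"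
proof -
  define K where "K = {Slot_Mark Typical}"
  define L where "L = - K"
  have [measurable]: "mark Typical \<in> measurable (info K) (count_space UNIV)"
    "bore Typical \<in> borel_measurable (info L)" "X n \<in> borel_measurable (info L)" for n
    by (auto simp: K_def L_def intro!: measurable_X_info measurable_bore_info measurable_mark_info)
  have "node n \<subseteq> L" for n by (auto simp: K_def L_def node_def)
  note [measurable] = measurable_node[OF this]
  have "prob {w \<in> space P. \<not> transmits M (mark Typical w) s} = 1 - 1 / M"
    using pos by (subst prob_neg) (auto simp: prob_transmits)
  also have "\<dots> \<noteq> 0" using assms by simp
  finally have nz: "prob {w \<in> space P. \<not> transmits M (mark Typical w) s} \<noteq> 0" .
  have "prob {w \<in> space P.
      (\<forall>n. \<not> device_exceeds (bore Typical w) (X n w) n w) \<and>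
      \<not> transmits M (mark Typical w) s}
    = prob {w \<in> space P.
        \<forall>n. \<not> device_exceeds (bore Typical w) (X n w) n w} *
      prob {w \<in> space P. \<not> transmits M (mark Typical w) s}"
  proof (rule prob_conj_info[of L K])
    show "L \<inter> K = {}" by (simp add: L_def)
  qed measurable
  then show ?thesis
    using nz by (simp add: cond_prob_def strongest_interferer_le_iff prob_no_exceed)
qed

end

theorem proposition1:
  fixes P :: "'w measure"
    and lam \<delta> \<phi> \<alpha> Pt Gm l \<omega> \<Omega> i :: real
    and M s :: nat
    and fad :: fading
    and X :: "nat \<Rightarrow> 'w \<Rightarrow> real ^ 2"
    and mark :: "device \<Rightarrow> 'w \<Rightarrow> nat"
    and bore :: "device \<Rightarrow> 'w \<Rightarrow> real"
    and zeta :: "nat \<Rightarrow> 'w \<Rightarrow> real"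
  assumes "lam > 0" and "M \<ge> 2" and "\<delta> = 1 / real M"
    and "0 < \<phi>" and "\<phi> \<le> 2 * pi" and "\<alpha> > 2"
    and "Pt > 0" and "Gm > 0" and "l > 0"
    and "\<omega> = Pt * Gm\<^sup>2 * l"
    and "\<Omega> = fading_factor fad \<alpha>"
    and "radar_network P lam M fad X mark bore zeta"
    and "i > 0"
  shows "\<P>(w in P. strongest_interferer Pt Gm l \<phi> \<alpha> M X mark bore zeta s w \<le> ennreal i
           \<bar> \<not> transmits M (mark Typical w) s)
         = exp (- (lam * \<delta> * \<phi>\<^sup>2 * \<Omega> * \<omega> powr (2 / \<alpha>) / (4 * pi)) * i powr (- 2 / \<alpha>))"
proof -
  interpret radar_network P lam M fad X mark bore zeta by fact
  interpret radar_detection P lam M fad X mark bore zeta s Pt Gm l \<phi> \<alpha> i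
    by unfold_locales (use assms in auto)
  have \<omega>: "0 < \<omega>" using assms by simp
  have "(i / \<omega>) powr (- 2 / \<alpha>) = \<omega> powr (2 / \<alpha>) * i powr (- 2 / \<alpha>)"
    using \<omega> \<open>i > 0\<close> by (simp add: powr_divide powr_minus field_simps)
  then have "lam * (\<phi>\<^sup>2 * fading_factor fad \<alpha> * (i / \<omega>) powr (- 2 / \<alpha>) / (4 * pi * M))
      = lam * \<delta> * \<phi>\<^sup>2 * \<Omega> * \<omega> powr (2 / \<alpha>) / (4 * pi) * i powr (- 2 / \<alpha>)"
    by (simp add: assms ac_simps)
  then show ?thesis
    using cond_prob_strongest_interferer[OF \<open>M \<ge> 2\<close>] by (simp add: assms)
qed

end
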